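(* The distributionally robust two-stage problem $$\mathop{\text{minimize}}_{\bm{x}\in\mathcal{X}}\; c(\bm{x}) + \sup_{\mathbb{P}\in\mathcal{P}} \mathbb{E}_{\mathbb{P}}\left[\mathcal{Q}(\bm{x},\tilde{\bm{\xi}})\right]$$ is equivalent to the problem $$\mathop{\text{minimize}}_{\bm{x}\in\mathcal{X},\,\alpha\geq 0}\; c(\bm{x}) + \alpha\varepsilon + \frac1N\sum_{i=1}^N Z_i(\bm{x},\alpha),$$ where, for each $i\in\{1,\ldots,N\}$, the function $Z_i:\mathcal{X}\times\mathbb{R}_+\to\mathbb{R}$ and the set $\mathcal{Z}_i$ are defined by $$Z_i(\bm{x},\alpha) = \mathop{\text{maximize}}_{(\bm{\xi},\bm{\lambda},\bm{\Lambda},\tau)\in \mathrm{cl\,conv}(\mathcal{Z}_i)} \left\{\langle \bm{T}(\bm{x}),\bm{\Lambda}\rangle + \bm{h}(\bm{x})^\top\bm{\lambda} - \alpha\tau\right\},$$ $$\mathcal{Z}_i = \left\{(\bm{\xi},\bm{\lambda},\bm{\Lambda},\tau)\in\Xi\times\mathbb{R}^L_+\times\mathbb{R}^{L\times M}\times\mathbb{R}_+ : \begin{array}{l} \bm{\Lambda} = \bm{\lambda}\bm{\xi}^\top,\; (\bm{\xi}-\hat{\bm{\xi}}^{(i)},\tau)\in\mathcal{C}^{M+1},\\ \bm{q}_0 + \bm{Q}\bm{\xi} - \bm{W}_0^\top\bm{\lambda} - \sum_{j=1}^M \bm{W}_j^\top\bm{\Lambda}\mathbf{e}_j \in \mathc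al{Y}^*\end{array}\right\}.$$
   Context: Equivalence means: for every fixed $\bm{x}\in\mathcal{X}$, the infimum of the second objective over the remaining variables equals the first objective at $\bm{x}$ (in particular the optimal values coincide). "maximize" denotes the supremum value. Setting. $\Xi\subseteq\{0,1\}^M$ is a support set; $\hat{\bm{\xi}}^{(1)},\ldots,\hat{\bm{\xi}}^{(N)}\in\Xi$ are given observations; $\hat{\mathbb{P}}_N=\frac1N\sum_{i=1}^N\delta_{\hat{\bm{\xi}}^{(i)}}$. $\mathcal{X}\subseteq\mathbb{R}^{N_1}$ is convex and compact, $c:\mathcal{X}\to\mathbb{R}$ is convex. The second-stage loss is $$\mathcal{Q}(\bm{x},\bm{\xi})=\inf_{\bm{y}\in\mathcal{Y}}\left\{\bm{q}(\bm{\xi})^\top\bm{y} : \bm{W}(\bm{\xi})\bm{y}\geq \bm{T}(\bm{x})\bm{\xi}+\bm{h}(\bm{x})\right\},$$ where $\mathcal{Y}\subseteq\mathbb{R}^{N_2}$ is a proper cone (closed, convex, pointed, full-dimensional) with dual cone $\mathcal{Y}^*$; $\bm{q}(\bm{\xi})=\bm{q}_0+\bm{Q}\bm{\xi}$ with $\bm{Q}\in\mathbb{R}^{N_2\times M}$; $\bm{W}(\bm{\xi})=\bm{W}_0+\sum_{j=1}^M\xi_j\bm{W}_j$ with $\bm{W}_j\in\mathbb{R}^{L\times N_2}$; $\bm{h}:\mathcal{X}\to\mathbb{R}^L$ and $\bm{T}:\mathcal{X}\to\mathbb{R}^{L\times M}$ are componentwise closed, proper, convex. Ambiguity set. $\mathcal{P}=\{\mathbb{Q}\in\mathcal{M}(\Xi):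 d_W(\mathbb{Q},\hat{\mathbb{P}}_N)\leq\varepsilon\}$ with $\varepsilon\geq0$, where $\mathcal{M}(\Xi)$ is the set of all distributions on $\Xi$ and $d_W(\mathbb{P},\mathbb{P}')=\min_\Pi\sum_{\bm{\xi},\bm{\xi}'\in\Xi}d(\bm{\xi},\bm{\xi}')\Pi(\bm{\xi},\bm{\xi}')$ over couplings $\Pi$ of $\mathbb{P},\mathbb{P}'$. The metric $d(\bm{\xi},\bm{\xi}')=\|\bm{\xi}-\bm{\xi}'\|$ is induced by an arbitrary norm on $\mathbb{R}^M$, and $\mathcal{C}^{M+1}=\{(\bm{v},t)\in\mathbb{R}^M\times\mathbb{R}:\|\bm{v}\|\leq t\}$ is the corresponding norm cone. Standing assumptions. (A1) For every $\bm{\xi}\in\Xi$ there exists $\bm{y}^+\in\mathrm{int}(\mathcal{Y})$ with $\bm{W}(\bm{\xi})\bm{y}^+>0$ (componentwise). (A2) For every $\bm{x}\in\mathcal{X}$ and $\bm{\xi}\in\Xi$, $\mathcal{Q}(\bm{x},\bm{\xi})$ is bounded (finite). Notation. $\langle\bm{A},\bm{B}\rangle=\sum_{i,j}A_{ij}B_{ij}$; $\mathbf{e}_j$ is the $j$th unit basis vector; $\mathrm{cl\,conv}$ is the closed convex hull. *)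

theory Defs
  imports "HOL-Probability.Probability"
begin

definition is_norm :: "('a::real_vector \<Rightarrow> real) \<Rightarrow> bool" where
  "is_norm nrm \<longleftrightarrow>
     (\<forall>v. 0 \<le> nrm v) \<and>
     (\<forall>v. nrm v = 0 \<longleftrightarrow> v = 0) \<and>
     (\<forall>a v. nrm (a *\<^sub>R v) = \<bar>a\<bar> * nrm v) \<and>
     (\<forall>v w. nrm (v + w) \<le> nrm v + nrm w)"

definition norm_cone :: "('a \<Rightarrow> real) \<Rightarrow> ('a \<times> real) set" where
  "norm_cone nrm = {(v, t). nrm v \<le> t}"

definition proper_cone :: "'a::euclidean_space set \<Rightarrow> bool" where
  "proper_cone K \<longleftrightarrow>
     closed K \<and> convex K \<and> cone K \<and>
     (\<forall>y. y \<in> K \<and> - y \<in> K \<longrightarrow> y = 0) \<and> interior K \<noteq> {}"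

definition dual_cone :: "'a::real_inner set \<Rightarrow> 'a set" where
  "dual_cone K = {z. \<forall>y\<in>K. 0 \<le> z \<bullet> y}"

(* For a real-valued function, closed means that the epigraph over S is closed,
   and proper means that the effective domain S is nonempty. *)
definition closed_proper_convex_on :: "'a::real_normed_vector set \<Rightarrow> ('a \<Rightarrow> real) \<Rightarrow> bool" where
  "closed_proper_convex_on S f \<longleftrightarrow> convex_on S f \<and> closed (epigraph S f) \<and> S \<noteq> {}"

definition outer :: "real ^ 'l \<Rightarrow> real ^ 'm \<Rightarrow> real ^ 'm ^ 'l" where
  "outer u v = (\<chi> i j. u $ i * v $ j)"

definition cost_vec :: "real ^ 'n \<Rightarrow> real ^ 'm ^ 'n \<Rightarrow> real ^ 'm \<Rightarrow> real ^ 'n" where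
  "cost_vec q0 Qm \<xi> = q0 + Qm *v \<xi>"

definition recourse_mat ::
  "real ^ 'n ^ 'l \<Rightarrow> ('m \<Rightarrow> real ^ 'n ^ 'l) \<Rightarrow> real ^ 'm::finite \<Rightarrow> real ^ 'n ^ 'l" where
  "recourse_mat W0 W \<xi> = W0 + (\<Sum>j\<in>UNIV. (\<xi> $ j) *\<^sub>R W j)"

(* Orders between vectors are spelled out componentwise: the library's strict order on
   real ^ 'l is not the componentwise strict one. *)
definition second_stage ::
  "(real ^ 'n) set \<Rightarrow> real ^ 'n \<Rightarrow> real ^ 'm ^ 'n \<Rightarrow> real ^ 'n ^ 'l \<Rightarrow> ('m \<Rightarrow> real ^ 'n ^ 'l) \<Rightarrow>
   ('x \<Rightarrow> real ^ 'm ^ 'l) \<Rightarrow> ('x \<Rightarrow> real ^ 'l) \<Rightarrow> 'x \<Rightarrow> real ^ 'm::finite \<Rightarrow> ereal" where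
  "second_stage Y q0 Qm W0 W T h x \<xi> =
     (INF y \<in> {y \<in> Y. \<forall>l. (recourse_mat W0 W \<xi> *v y) $ l \<ge> (T x *v \<xi> + h x) $ l}.
        ereal (cost_vec q0 Qm \<xi> \<bullet> y))"

(* (1/N) times the sum of the point masses at xihat 1, ..., xihat N, with multiplicities. *)
definition empirical :: "nat \<Rightarrow> (nat \<Rightarrow> 'a) \<Rightarrow> 'a pmf" where
  "empirical N xihat = map_pmf xihat (pmf_of_set {1..N})"

definition couplings :: "'a pmf \<Rightarrow> 'a pmf \<Rightarrow> ('a \<times> 'a) pmf set" where
  "couplings P P' = {\<gamma>. map_pmf fst \<gamma> = P \<and> map_pmf snd \<gamma> = P'}"

(* For P and P' supported on a finite set S. *)
definition wasserstein ::
  "'a set \<Rightarrow> ('a \<Rightarrow> 'a \<Rightarrow> real) \<Rightarrow> 'a pmf \<Rightarrow> 'a pmf \<Rightarrow> real" where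
  "wasserstein S d P P' =
     (INF \<gamma> \<in> couplings P P'. \<Sum>(\<xi>, \<xi>')\<in>S \<times> S. d \<xi> \<xi>' * pmf \<gamma> (\<xi>, \<xi>'))"

definition ambiguity_set ::
  "(real ^ 'm) set \<Rightarrow> (real ^ 'm \<Rightarrow> real) \<Rightarrow> nat \<Rightarrow> (nat \<Rightarrow> real ^ 'm) \<Rightarrow> real \<Rightarrow> (real ^ 'm) pmf set"
  where
  "ambiguity_set \<Xi> nrm N xihat \<epsilon> =
     {P. set_pmf P \<subseteq> \<Xi> \<and>
         wasserstein \<Xi> (\<lambda>\<xi> \<xi>'. nrm (\<xi> - \<xi>')) P (empirical N xihat) \<le> \<epsilon>}"

(* The loss is meant to be finite on the support of P; there real_of_ereal loses nothing. *)
definition expected_loss :: "'a pmf \<Rightarrow> ('a \<Rightarrow> ereal) \<Rightarrow> real" where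
  "expected_loss P f = measure_pmf.expectation P (\<lambda>\<xi>. real_of_ereal (f \<xi>))"

definition lifted_set ::
  "(real ^ 'm) set \<Rightarrow> (real ^ 'm \<Rightarrow> real) \<Rightarrow> (real ^ 'n) set \<Rightarrow> real ^ 'n \<Rightarrow> real ^ 'm ^ 'n \<Rightarrow>
   real ^ 'n ^ 'l \<Rightarrow> ('m \<Rightarrow> real ^ 'n ^ 'l) \<Rightarrow> real ^ 'm \<Rightarrow>
   ((real ^ 'm::finite) \<times> (real ^ 'l) \<times> (real ^ 'm ^ 'l) \<times> real) set" where
  "lifted_set \<Xi> nrm Y q0 Qm W0 W xihati =
     {(\<xi>, lam, \<Lambda>, \<tau>). \<xi> \<in> \<Xi> \<and> (\<forall>l. 0 \<le> lam $ l) \<and> 0 \<le> \<tau> \<and>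
        \<Lambda> = outer lam \<xi> \<and>
        (\<xi> - xihati, \<tau>) \<in> norm_cone nrm \<and>
        q0 + Qm *v \<xi> - transpose W0 *v lam
          - (\<Sum>j\<in>UNIV. transpose (W j) *v (\<Lambda> *v axis j 1)) \<in> dual_cone Y}"

(* T x \<bullet> \<Lambda> is the entrywise (Frobenius) inner product of matrices. *)
definition Zval ::
  "('x \<Rightarrow> real ^ 'm ^ 'l) \<Rightarrow> ('x \<Rightarrow> real ^ 'l) \<Rightarrow>
   ((real ^ 'm) \<times> (real ^ 'l) \<times> (real ^ 'm ^ 'l) \<times> real) set \<Rightarrow> 'x \<Rightarrow> real \<Rightarrow> ereal" where
  "Zval T h Z x \<alpha> =
     (SUP (\<xi>, lam, \<Lambda>, \<tau>) \<in> closure (convex hull Z). ereal (T x \<bullet> \<Lambda> + h x \<bullet> lam - \<alpha> * \<tau>))"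

definition dro_objective ::
  "('x \<Rightarrow> real) \<Rightarrow> ('x \<Rightarrow> 'a \<Rightarrow> ereal) \<Rightarrow> 'a pmf set \<Rightarrow> 'x \<Rightarrow> ereal" where
  "dro_objective c Q \<P> x = ereal (c x) + (SUP P\<in>\<P>. ereal (expected_loss P (Q x)))"

definition reformulated_objective ::
  "('x \<Rightarrow> real) \<Rightarrow> real \<Rightarrow> nat \<Rightarrow> (nat \<Rightarrow> 'x \<Rightarrow> real \<Rightarrow> ereal) \<Rightarrow> 'x \<Rightarrow> real \<Rightarrow> ereal" where
  "reformulated_objective c \<epsilon> N Z x \<alpha> =
     ereal (c x + \<alpha> * \<epsilon>) + ereal (1 / real N) * (\<Sum>i = 1..N. Z i x \<alpha>)"

end

theory Submission
  imports Defs
begin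

text \<open>For fixed \<open>x\<close> the bilinear constraint \<open>\<Lambda> = \<lambda> \<xi>\<^sup>T\<close> turns the cone constraint of the lifted set
  into feasibility of \<open>\<lambda>\<close> for the conic dual of the second stage, which by (A1) has no duality gap
  and an optimal solution. A linear functional does not see the closed convex hull, so
  \<open>Z\<^sub>i(x, \<alpha>)\<close> is the maximum of \<open>Q(x, \<xi>) - \<alpha> d(\<xi>, \<xi>\<^sub>i)\<close> over the finite set \<open>\<Xi>\<close>. What is left is
  Wasserstein duality on a finite set. There the sum of the maxima is a maximum over selections
  \<open>\<phi>\<close>, each giving a point (average transport cost, average loss) of the plane, and a dual optimal
  \<open>\<alpha>\<close>, also for \<open>\<epsilon> = 0\<close>, is the slope of a line above these finitely many points.\<close>

section \<open>Conic duality\<close>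

lemma conic_weak_duality:
  fixes A :: "real ^ 'n ^ 'l"
  assumes "y \<in> Y" "\<And>l. b $ l \<le> (A *v y) $ l" "\<And>l. 0 \<le> lam $ l"
    and "q - transpose A *v lam \<in> dual_cone Y"
  shows "b \<bullet> lam \<le> q \<bullet> y"
proof -
  have "b \<bullet> lam \<le> (A *v y) \<bullet> lam"
    unfolding inner_vec_def by (rule sum_mono) (simp add: assms mult_right_mono)
  also have "\<dots> = (transpose A *v lam) \<bullet> y"
    by (metis dot_lmul_matrix inner_commute vector_transpose_matrix transpose_transpose)
  also have "\<dots> \<le> q \<bullet> y"
    using assms(1,4) by (auto simp: dual_cone_def inner_diff_left)
  finally show ?thesis .
qed

text \<open>The origin is separated from a convex set of pairs (objective gap, constraint slack),
  and the normal vector supplies the multiplier. The Slater point \<open>yp\<close> rules out a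
  normal with zero objective part. The number \<open>v\<close> is any lower bound of the primal, so
  applying this to the optimal value yields an optimal dual solution.\<close>

lemma conic_strong_duality:
  fixes A :: "real ^ 'n ^ 'l"
  assumes Y: "convex Y" "cone Y"
    and yp: "yp \<in> Y" "\<And>l. 0 < (A *v yp) $ l"
    and v: "\<And>y. y \<in> Y \<Longrightarrow> \<forall>l. b $ l \<le> (A *v y) $ l \<Longrightarrow> v \<le> q \<bullet> y"
  obtains lam where "\<And>l. 0 \<le> lam $ l" "q - transpose A *v lam \<in> dual_cone Y" "v \<le> b \<bullet> lam"
proof -
  have scale: "t *\<^sub>R y \<in> Y" if "y \<in> Y" "0 \<le> t" for t y
    using Y(2) that by (simp add: cone_def)
  have zero: "0 \<in> Y" using scale[OF yp(1), of 0] by simp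
  \<comment> \<open>The strict \<open>0 < r\<close> keeps the origin out: a zero of both components
    would be a feasible \<open>y\<close> with value below \<open>v\<close>.\<close>
  define E where "E = {(q \<bullet> y - v + r, A *v y - b - s) | y r s.
     y \<in> Y \<and> 0 < r \<and> (\<forall>l. 0 \<le> s $ l)}"
  have EI: "(q \<bullet> y - v + r, A *v y - b - s) \<in> E" if "y \<in> Y" "0 < r" "\<forall>l. 0 \<le> s $ l" for y r s
    using that unfolding E_def by blast
  have "0 \<notin> E"
  proof
    assume "0 \<in> E"
    then obtain y r s where *: "y \<in> Y" "0 < r" "\<forall>l. 0 \<le> s $ l" "q \<bullet> y - v + r = 0"
        "A *v y - b - s = 0"
      unfolding E_def zero_prod_def by force
    have "A *v y = b + s" using *(5) by (simp add: algebra_simps)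
    then have "v \<le> q \<bullet> y" using v[OF *(1)] *(3) by simp
    then show False using *(2,4) by simp
  qed
  moreover have "convex E"
  proof (rule convexI)
    fix e e' and u w :: real
    assume e: "e \<in> E" "e' \<in> E" and uw: "0 \<le> u" "0 \<le> w" "u + w = 1"
    obtain y r s where 1: "y \<in> Y" "0 < r" "\<forall>l. 0 \<le> s $ l" "e = (q \<bullet> y - v + r, A *v y - b - s)"
      using e(1) unfolding E_def by blast
    obtain y' r' s' where 2: "y' \<in> Y" "0 < r'" "\<forall>l. 0 \<le> s' $ l"
        "e' = (q \<bullet> y' - v + r', A *v y' - b - s')"
      using e(2) unfolding E_def by blast
    have w: "w = 1 - u" using uw by simp
    have "u *\<^sub>R e + w *\<^sub>R e' = (q \<bullet> (u *\<^sub>R y + w *\<^sub>R y') - v + (u * r + w * r'),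
        A *v (u *\<^sub>R y + w *\<^sub>R y') - b - (u *\<^sub>R s + w *\<^sub>R s'))"
      unfolding 1(4) 2(4) w
      by (simp add: algebra_simps matrix_vector_right_distrib matrix_vector_mult_scaleR
          inner_add_right inner_diff_right matrix_vector_mult_diff_distrib)
    moreover have "0 < u * r + w * r'"
      using 1(2) 2(2) uw
      by (metis add_nonneg_pos add_pos_nonneg le_less mult_nonneg_nonneg mult_pos_pos zero_less_one
          add.right_neutral)
    moreover have "u *\<^sub>R y + w *\<^sub>R y' \<in> Y"
      using Y(1) 1(1) 2(1) uw by (simp add: convex_def)
    moreover have "\<forall>l. 0 \<le> (u *\<^sub>R s + w *\<^sub>R s') $ l"
      using 1(3) 2(3) uw by simp
    ultimately show "u *\<^sub>R e + w *\<^sub>R e' \<in> E" using EI by metis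
  qed
  ultimately obtain a where a: "a \<noteq> 0" "\<And>e. e \<in> E \<Longrightarrow> 0 \<le> a \<bullet> e"
    using separating_hyperplane_set_0 by metis
  \<comment> \<open>The second component of \<open>E\<close> can be lowered freely through
    \<open>s\<close>, so the normal is nonpositive there. The sign change makes \<open>\<mu>\<close>
    a nonnegative multiplier.\<close>
  define \<rho> where "\<rho> = fst a"
  define \<mu> where "\<mu> = - snd a"
  have sep: "0 \<le> \<rho> * (q \<bullet> y - v + r) - \<mu> \<bullet> (A *v y - b - s)"
    if "y \<in> Y" "0 < r" "\<forall>l. 0 \<le> s $ l" for y r s
    using a(2)[OF EI[OF that]] by (cases a) (simp add: \<rho>_def \<mu>_def)
  \<comment> \<open>An affine function that stays nonnegative along a ray has nonnegative slope. It
    is applied along \<open>r\<close>, along a coordinate of \<open>s\<close>, along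
    \<open>yp\<close>, and along a general ray of the cone.\<close>
  have nonneg_slope: "0 \<le> k" if "\<And>t. 0 < t \<Longrightarrow> 0 \<le> k * t + m" for k m :: real
  proof (rule ccontr)
    assume "\<not> 0 \<le> k"
    then have "0 < (\<bar>m\<bar> + 1) / - k" "k * ((\<bar>m\<bar> + 1) / - k) = - (\<bar>m\<bar> + 1)"
      by (auto simp: divide_pos_neg add_nonneg_pos)
    then show False using that[of "(\<bar>m\<bar> + 1) / - k"] by linarith
  qed
  have \<rho>0: "0 \<le> \<rho>"
    by (rule nonneg_slope[of _ "\<rho> * (- v) + \<mu> \<bullet> b"])
       (use sep[OF zero, of _ 0] in \<open>simp add: algebra_simps\<close>)
  have \<mu>0: "0 \<le> \<mu> $ l" for l
  proof (rule nonneg_slope)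
    fix t :: real assume "0 < t"
    then have "\<forall>k. 0 \<le> (t *\<^sub>R axis l 1 :: real ^ 'l) $ k" by (simp add: axis_def)
    from sep[OF zero zero_less_one this]
    show "0 \<le> \<mu> $ l * t + (\<rho> * (1 - v) + \<mu> \<bullet> b)"
      by (simp add: algebra_simps inner_axis inner_add_right inner_diff_right)
  qed
  have "\<rho> \<noteq> 0"
  proof
    assume "\<rho> = 0"
    then have "\<mu> \<noteq> 0" using a(1) by (simp add: \<rho>_def \<mu>_def prod_eq_iff)
    then obtain l where l: "\<mu> $ l \<noteq> 0" by (auto simp: vec_eq_iff)
    have "0 \<le> - (\<mu> \<bullet> (A *v yp))"
    proof (rule nonneg_slope)
      fix t :: real assume "0 < t"
      then show "0 \<le> - (\<mu> \<bullet> (A *v yp)) * t + \<mu> \<bullet> b"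
        using sep[OF scale[OF yp(1), of t], of 1 0] \<open>\<rho> = 0\<close>
        by (simp add: algebra_simps matrix_vector_mult_scaleR inner_diff_right)
    qed
    moreover have "0 < \<mu> \<bullet> (A *v yp)"
      unfolding inner_vec_def
      by (rule sum_pos2[of _ l]) (use l \<mu>0 yp(2) in \<open>auto simp: less_le\<close>)
    ultimately show False by simp
  qed
  with \<rho>0 have \<rho>: "0 < \<rho>" by simp
  define lam where "lam = (1 / \<rho>) *\<^sub>R \<mu>"
  \<comment> \<open>Letting \<open>r\<close> tend to 0 leaves the Lagrangian bound on
    \<open>Y\<close>. At \<open>y = 0\<close> it gives the value of \<open>lam\<close>, and along
    rays it gives dual feasibility.\<close>
  have lag: "0 \<le> q \<bullet> y - v - lam \<bullet> (A *v y) + lam \<bullet> b" if "y \<in> Y" for y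
  proof (rule field_le_epsilon)
    fix r :: real assume "0 < r"
    have "0 \<le> (\<rho> * (q \<bullet> y - v + r) - \<mu> \<bullet> (A *v y - b - 0)) / \<rho>"
      using sep[OF that \<open>0 < r\<close>, of 0] \<rho> by (intro divide_nonneg_pos) auto
    then show "0 \<le> q \<bullet> y - v - lam \<bullet> (A *v y) + lam \<bullet> b + r"
      using \<rho> by (simp add: lam_def field_simps inner_diff_right)
  qed
  show thesis
  proof
    show "0 \<le> lam $ l" for l using \<mu>0 \<rho> by (simp add: lam_def)
    show "v \<le> b \<bullet> lam" using lag[OF zero] by (simp add: inner_commute)
    have "0 \<le> (q - transpose A *v lam) \<bullet> y" if "y \<in> Y" for y
    proof (rule nonneg_slope)
      fix t :: real assume "0 < t"
      have "(transpose A *v lam) \<bullet> y = lam \<bullet> (A *v y)"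
        by (metis dot_lmul_matrix inner_commute vector_transpose_matrix transpose_transpose)
      then show "0 \<le> (q - transpose A *v lam) \<bullet> y * t + (lam \<bullet> b - v)"
        using lag[OF scale[OF that, of t]] \<open>0 < t\<close>
        by (simp add: algebra_simps inner_diff_left matrix_vector_mult_scaleR)
    qed
    then show "q - transpose A *v lam \<in> dual_cone Y" by (simp add: dual_cone_def)
  qed
qed

section \<open>The lifted set\<close>

lemma inner_outer: "B \<bullet> outer u v = (B *v v) \<bullet> u"
  for B :: "real ^ 'm ^ 'l"
  by (simp add: inner_vec_def outer_def matrix_vector_mult_def sum_distrib_left algebra_simps)

lemma outer_mult_axis: "outer u v *v axis j 1 = (v $ j) *\<^sub>R u"
  by (simp add: vec_eq_iff outer_def matrix_vector_mul_component inner_axis)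

text \<open>Column \<open>j\<close> of \<open>outer lam \<xi>\<close> is
  \<open>(\<xi> $ j) *\<^sub>R lam\<close>, so the expression that is linear in the lifted variables
  is the adjoint of the recourse matrix applied to \<open>lam\<close>.\<close>

lemma transpose_recourse_mat:
  "transpose (recourse_mat W0 W \<xi>) *v lam =
     transpose W0 *v lam + (\<Sum>j\<in>UNIV. transpose (W j) *v (outer lam \<xi> *v axis j 1))"
proof -
  have "(\<Sum>j\<in>UNIV. transpose (W j) *v (outer lam \<xi> *v axis j 1)) $ k =
      (\<Sum>l\<in>UNIV. (\<Sum>j\<in>UNIV. \<xi> $ j * W j $ l $ k) * lam $ l)" for k
    unfolding outer_mult_axis sum_component sum_distrib_right
    by (subst sum.swap) (simp add: matrix_vector_mult_def transpose_def sum_distrib_left algebra_simps)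
  then show ?thesis
    by (simp add: vec_eq_iff recourse_mat_def matrix_vector_mult_def transpose_def
        algebra_simps sum.distrib)
qed

lemma mem_lifted_set_iff:
  "(\<xi>, lam, \<Lambda>, \<tau>) \<in> lifted_set \<Xi> nrm Y q0 Qm W0 W \<zeta> \<longleftrightarrow>
     \<xi> \<in> \<Xi> \<and> (\<forall>l. 0 \<le> lam $ l) \<and> 0 \<le> \<tau> \<and> \<Lambda> = outer lam \<xi> \<and> nrm (\<xi> - \<zeta>) \<le> \<tau> \<and>
     cost_vec q0 Qm \<xi> - transpose (recourse_mat W0 W \<xi>) *v lam \<in> dual_cone Y"
  unfolding lifted_set_def norm_cone_def cost_vec_def transpose_recourse_mat diff_diff_eq by blast

lemma Zval_eq_max:
  fixes Z :: "((real ^ 'm) \<times> (real ^ 'l) \<times> (real ^ 'm ^ 'l) \<times> real) set"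
  assumes upper: "\<And>\<xi> lam \<Lambda> \<tau>. (\<xi>, lam, \<Lambda>, \<tau>) \<in> Z \<Longrightarrow> T x \<bullet> \<Lambda> + h x \<bullet> lam - \<alpha> * \<tau> \<le> m"
    and attained: "(\<xi>', lam', \<Lambda>', \<tau>') \<in> Z" "m \<le> T x \<bullet> \<Lambda>' + h x \<bullet> lam' - \<alpha> * \<tau>'"
  shows "Zval T h Z x \<alpha> = ereal m"
proof (rule antisym)
  \<comment> \<open>The objective is the inner product with \<open>a\<close>. The first entry is 0
    since \<xi> enters only through the other variables. Hence the upper bound on \<open>Z\<close>
    describes a closed half-space, which contains the closed convex hull as well.\<close>
  define a where "a = (0 :: real ^ 'm, h x, T x, - \<alpha>)"
  have "Z \<subseteq> {z. a \<bullet> z \<le> m}"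
    using upper by (auto simp: a_def algebra_simps)
  then have "closure (convex hull Z) \<subseteq> {z. a \<bullet> z \<le> m}"
    by (intro closure_minimal hull_minimal convex_halfspace_le closed_halfspace_le)
  then show "Zval T h Z x \<alpha> \<le> ereal m"
    unfolding Zval_def by (intro SUP_least) (auto simp: a_def algebra_simps)
  have "(\<xi>', lam', \<Lambda>', \<tau>') \<in> closure (convex hull Z)"
    by (rule subsetD[OF closure_subset], rule hull_inc, rule attained(1))
  then show "ereal m \<le> Zval T h Z x \<alpha>"
    unfolding Zval_def by (rule SUP_upper2) (use attained(2) in auto)
qed

text \<open>For fixed \<xi> the best \<tau> is the distance \<open>nrm (\<xi> - \<zeta>)\<close>,
  because \<alpha> is nonnegative, and the best \<open>lam\<close> is dual optimal with value
  \<open>f \<xi>\<close>. What remains is a maximum over the finite set \<Xi>.\<close>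

lemma Zval_lifted_set:
  fixes \<Xi> :: "(real ^ 'm) set" and W0 :: "real ^ 'n ^ 'l" and T :: "'x \<Rightarrow> real ^ 'm ^ 'l"
  assumes fin: "finite \<Xi>" "\<Xi> \<noteq> {}"
    and Y: "convex Y" "cone Y"
    and nrm: "is_norm nrm" and \<alpha>: "0 \<le> \<alpha>"
    and slater: "\<And>\<xi>. \<xi> \<in> \<Xi> \<Longrightarrow> \<exists>y\<in>Y. \<forall>l. 0 < (recourse_mat W0 W \<xi> *v y) $ l"
    and Q: "\<And>\<xi>. \<xi> \<in> \<Xi> \<Longrightarrow> second_stage Y q0 Qm W0 W T h x \<xi> = ereal (f \<xi>)"
  shows "Zval T h (lifted_set \<Xi> nrm Y q0 Qm W0 W \<zeta>) x \<alpha> =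
    ereal (MAX \<xi>\<in>\<Xi>. f \<xi> - \<alpha> * nrm (\<xi> - \<zeta>))"
proof -
  let ?g = "\<lambda>\<xi>. f \<xi> - \<alpha> * nrm (\<xi> - \<zeta>)"
  have f_le: "f \<xi> \<le> cost_vec q0 Qm \<xi> \<bullet> y"
    if "\<xi> \<in> \<Xi>" "y \<in> Y" "\<forall>l. (T x *v \<xi> + h x) $ l \<le> (recourse_mat W0 W \<xi> *v y) $ l" for \<xi> y
  proof -
    have "second_stage Y q0 Qm W0 W T h x \<xi> \<le> ereal (cost_vec q0 Qm \<xi> \<bullet> y)"
      unfolding second_stage_def by (rule INF_lower) (use that in simp)
    then show ?thesis using Q[OF that(1)] by simp
  qed
  have le_f: "(T x *v \<xi> + h x) \<bullet> lam \<le> f \<xi>"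
    if "\<xi> \<in> \<Xi>" "\<forall>l. 0 \<le> lam $ l"
      "cost_vec q0 Qm \<xi> - transpose (recourse_mat W0 W \<xi>) *v lam \<in> dual_cone Y" for \<xi> lam
  proof -
    have "ereal ((T x *v \<xi> + h x) \<bullet> lam) \<le> second_stage Y q0 Qm W0 W T h x \<xi>"
      unfolding second_stage_def
      by (rule INF_greatest) (use that in \<open>auto intro!: conic_weak_duality\<close>)
    then show ?thesis using Q[OF that(1)] by simp
  qed
  have "Max (?g ` \<Xi>) \<in> ?g ` \<Xi>" using fin by (intro Max_in) auto
  then obtain \<xi>' where \<xi>': "\<xi>' \<in> \<Xi>" "Max (?g ` \<Xi>) = ?g \<xi>'" by blast
  obtain yp where "yp \<in> Y" "\<forall>l. 0 < (recourse_mat W0 W \<xi>' *v yp) $ l"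
    using slater[OF \<xi>'(1)] by blast
  then obtain lam' where lam': "\<And>l. 0 \<le> lam' $ l"
      "cost_vec q0 Qm \<xi>' - transpose (recourse_mat W0 W \<xi>') *v lam' \<in> dual_cone Y"
      "f \<xi>' \<le> (T x *v \<xi>' + h x) \<bullet> lam'"
    using conic_strong_duality[OF Y _ _ f_le[OF \<xi>'(1)]] by metis
  show ?thesis
  proof (rule Zval_eq_max)
    show "(\<xi>', lam', outer lam' \<xi>', nrm (\<xi>' - \<zeta>)) \<in> lifted_set \<Xi> nrm Y q0 Qm W0 W \<zeta>"
      using \<xi>' lam' nrm by (simp add: mem_lifted_set_iff is_norm_def)
    show "Max (?g ` \<Xi>) \<le> T x \<bullet> outer lam' \<xi>' + h x \<bullet> lam' - \<alpha> * nrm (\<xi>' - \<zeta>)"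
      using lam'(3) \<xi>'(2) by (simp add: inner_outer inner_add_left)
    fix \<xi> lam \<Lambda> \<tau> assume "(\<xi>, lam, \<Lambda>, \<tau>) \<in> lifted_set \<Xi> nrm Y q0 Qm W0 W \<zeta>"
    then have *: "\<xi> \<in> \<Xi>" "\<forall>l. 0 \<le> lam $ l" "\<Lambda> = outer lam \<xi>" "nrm (\<xi> - \<zeta>) \<le> \<tau>"
        "cost_vec q0 Qm \<xi> - transpose (recourse_mat W0 W \<xi>) *v lam \<in> dual_cone Y"
      by (auto simp: mem_lifted_set_iff)
    have "T x \<bullet> \<Lambda> + h x \<bullet> lam - \<alpha> * \<tau> \<le> ?g \<xi>"
      using le_f[OF *(1,2,5)] mult_left_mono[OF *(4) \<alpha>] *(3)
      by (simp add: inner_outer inner_add_left)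
    also have "\<dots> \<le> Max (?g ` \<Xi>)" using fin *(1) by (intro Max_ge) auto
    finally show "T x \<bullet> \<Lambda> + h x \<bullet> lam - \<alpha> * \<tau> \<le> Max (?g ` \<Xi>)" .
  qed
qed

section \<open>Wasserstein duality on a finite space\<close>

text \<open>Here \<open>f\<close> stands for the second-stage loss at one fixed decision; the
  minimization over decisions stays outside.\<close>

locale finite_transport =
  fixes S :: "'a set" and d :: "'a \<Rightarrow> 'a \<Rightarrow> real" and N :: nat and xihat :: "nat \<Rightarrow> 'a"
    and f :: "'a \<Rightarrow> real" and \<epsilon> :: real
  assumes fin: "finite S" and N_pos: "1 \<le> N" and obs: "\<And>i. i \<in> {1..N} \<Longrightarrow> xihat i \<in> S"
    and d_nonneg: "\<And>a b. 0 \<le> d a b" and d_self: "\<And>a. d a a = 0" and eps: "0 \<le> \<epsilon>"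
begin

definition wball :: "'a pmf set" where
  "wball = {P. set_pmf P \<subseteq> S \<and> wasserstein S d P (empirical N xihat) \<le> \<epsilon>}"

text \<open>This is the Lagrangian dual function of the transport budget, with multiplier \<alpha>:
  once the budget is priced, the inner maximization splits over the observations.\<close>

definition dual_value :: "real \<Rightarrow> real" where
  "dual_value \<alpha> = \<alpha> * \<epsilon> + (\<Sum>i=1..N. MAX \<xi>\<in>S. f \<xi> - \<alpha> * d \<xi> (xihat i)) / N"

lemma S_nonempty: "S \<noteq> {}"
  using obs[of 1] N_pos by auto

lemma set_empirical: "set_pmf (empirical N xihat) \<subseteq> S"
  using N_pos obs by (auto simp: empirical_def set_pmf_of_set)

lemma expectation_empirical:
  "measure_pmf.expectation (map_pmf g (pmf_of_set {1..N})) u = (\<Sum>i=1..N. u (g i)) / N"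
  for u :: "'b \<Rightarrow> real"
  using N_pos by (simp add: integral_pmf_of_set)

lemma transport_cost_eq_expectation:
  assumes "set_pmf \<gamma> \<subseteq> S \<times> S"
  shows "(\<Sum>(\<xi>, \<xi>')\<in>S \<times> S. d \<xi> \<xi>' * pmf \<gamma> (\<xi>, \<xi>')) = measure_pmf.expectation \<gamma> (\<lambda>(\<xi>, \<xi>'). d \<xi> \<xi>')"
  using assms fin
  by (subst integral_measure_pmf_real[of "S \<times> S"]) (auto intro!: sum.cong)

lemma coupling_support:
  assumes "\<gamma> \<in> couplings P (empirical N xihat)" "set_pmf P \<subseteq> S"
  shows "set_pmf \<gamma> \<subseteq> S \<times> S"
proof -
  have "fst ` set_pmf \<gamma> \<subseteq> S" "snd ` set_pmf \<gamma> \<subseteq> S"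
    using assms set_empirical by (auto simp: couplings_def simp flip: set_map_pmf)
  then show ?thesis by force
qed

lemma wasserstein_le_transport_cost:
  assumes "\<gamma> \<in> couplings P P'"
  shows "wasserstein S d P P' \<le> (\<Sum>(\<xi>, \<xi>')\<in>S \<times> S. d \<xi> \<xi>' * pmf \<gamma> (\<xi>, \<xi>'))"
  unfolding wasserstein_def
proof (rule cINF_lower[OF _ assms])
  show "bdd_below ((\<lambda>\<gamma>. \<Sum>(\<xi>, \<xi>')\<in>S \<times> S. d \<xi> \<xi>' * pmf \<gamma> (\<xi>, \<xi>')) ` couplings P P')"
    by (rule bdd_belowI[of _ 0]) (auto intro!: sum_nonneg simp: d_nonneg)
qed

text \<open>The pointwise bound of \<open>f \<xi>\<close> by the priced distance plus the maximum at
  the observation is integrated against a coupling, whose second marginal is the empirical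
  distribution.\<close>

lemma weak_duality:
  assumes P: "P \<in> wball" and \<alpha>: "0 \<le> \<alpha>"
  shows "measure_pmf.expectation P f \<le> dual_value \<alpha>"
proof -
  let ?C = "couplings P (empirical N xihat)"
  let ?m = "\<lambda>\<zeta>. MAX \<xi>\<in>S. f \<xi> - \<alpha> * d \<xi> \<zeta>"
  have supp: "set_pmf P \<subseteq> S" and w: "wasserstein S d P (empirical N xihat) \<le> \<epsilon>"
    using P by (auto simp: wball_def)
  \<comment> \<open>The product coupling shows that the infimum defining the distance ranges over a
    nonempty set.\<close>
  have "pair_pmf P (empirical N xihat) \<in> ?C"
    by (simp add: couplings_def map_fst_pair_pmf map_snd_pair_pmf)
  then have ne: "?C \<noteq> {}" by blast
  \<comment> \<open>A coupling is taken within \<open>\<delta>\<close> of the budget, which avoids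
    proving that the infimum is attained.\<close>
  have near: "measure_pmf.expectation P f \<le> dual_value \<alpha> + \<alpha> * \<delta>" if "0 < \<delta>" for \<delta>
  proof -
    have "wasserstein S d P (empirical N xihat) < \<epsilon> + \<delta>" using w that by simp
    then obtain \<gamma> where \<gamma>: "\<gamma> \<in> ?C"
        "(\<Sum>(\<xi>, \<xi>')\<in>S \<times> S. d \<xi> \<xi>' * pmf \<gamma> (\<xi>, \<xi>')) < \<epsilon> + \<delta>"
      unfolding wasserstein_def using cInf_lessD[of "_ ` ?C"] ne by blast
    have sub: "set_pmf \<gamma> \<subseteq> S \<times> S" using coupling_support[OF \<gamma>(1) supp] .
    have fing: "finite (set_pmf \<gamma>)" using sub fin by (meson finite_SigmaI finite_subset)
    note int = integrable_measure_pmf_finite[OF fing]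
    have cost: "measure_pmf.expectation \<gamma> (\<lambda>z. d (fst z) (snd z)) \<le> \<epsilon> + \<delta>"
      using \<gamma>(2) unfolding transport_cost_eq_expectation[OF sub] case_prod_beta by simp
    have "measure_pmf.expectation P f = measure_pmf.expectation \<gamma> (\<lambda>z. f (fst z))"
      using \<gamma>(1) by (auto simp: couplings_def simp flip: integral_map_pmf)
    also have "\<dots> \<le> measure_pmf.expectation \<gamma> (\<lambda>z. \<alpha> * d (fst z) (snd z) + ?m (snd z))"
    proof (rule integral_mono_AE[OF int int], unfold AE_measure_pmf_iff, rule ballI)
      fix z assume "z \<in> set_pmf \<gamma>"
      then have "fst z \<in> S" using sub by auto
      then have "f (fst z) - \<alpha> * d (fst z) (snd z) \<le> ?m (snd z)"
        using fin by (intro Max_ge) auto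
      then show "f (fst z) \<le> \<alpha> * d (fst z) (snd z) + ?m (snd z)" by simp
    qed
    also have "\<dots> = \<alpha> * measure_pmf.expectation \<gamma> (\<lambda>z. d (fst z) (snd z)) +
        measure_pmf.expectation \<gamma> (\<lambda>z. ?m (snd z))"
      by (simp add: Bochner_Integration.integral_add[OF int int])
    also have "measure_pmf.expectation \<gamma> (\<lambda>z. ?m (snd z)) =
        measure_pmf.expectation (map_pmf snd \<gamma>) ?m" by simp
    also have "\<dots> = measure_pmf.expectation (empirical N xihat) ?m"
      using \<gamma>(1) by (simp add: couplings_def)
    also have "\<dots> = (\<Sum>i=1..N. ?m (xihat i)) / N"
      unfolding empirical_def by (rule expectation_empirical)
    finally show ?thesis
      using mult_left_mono[OF cost \<alpha>] by (simp add: dual_value_def algebra_simps)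
  qed
  show ?thesis
  proof (rule field_le_epsilon)
    fix e :: real assume "0 < e"
    \<comment> \<open>The denominator \<open>\<alpha> + 1\<close> stays positive when \<alpha> is
      0.\<close>
    then have "\<alpha> * (e / (\<alpha> + 1)) \<le> e" using \<alpha> by (simp add: field_simps)
    then show "measure_pmf.expectation P f \<le> dual_value \<alpha> + e"
      using near[of "e / (\<alpha> + 1)"] \<open>0 < e\<close> \<alpha> by simp
  qed
qed

text \<open>Selections are indexed by \<open>i\<close> and not by the value \<open>xihat i\<close>,
  so coinciding observations may be sent to different points.\<close>

definition mean_cost :: "(nat \<Rightarrow> 'a) \<Rightarrow> real" where
  "mean_cost \<phi> = (\<Sum>i=1..N. d (\<phi> i) (xihat i)) / N"

definition mean_gain :: "(nat \<Rightarrow> 'a) \<Rightarrow> real" where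
  "mean_gain \<phi> = (\<Sum>i=1..N. f (\<phi> i)) / N"

text \<open>Moving the atom \<open>xihat i\<close> to \<open>\<phi> i\<close> with probability \<open>\<theta>\<close> and to \<open>\<psi> i\<close>
  otherwise is a transport plan.\<close>
lemma mixture_in_wball:
  assumes \<phi>: "\<phi> \<in> {1..N} \<rightarrow> S" and \<psi>: "\<psi> \<in> {1..N} \<rightarrow> S" and \<theta>: "0 \<le> \<theta>" "\<theta> \<le> 1"
    and cost: "\<theta> * mean_cost \<phi> + (1 - \<theta>) * mean_cost \<psi> \<le> \<epsilon>"
  obtains P where "P \<in> wball"
    "measure_pmf.expectation P f = \<theta> * mean_gain \<phi> + (1 - \<theta>) * mean_gain \<psi>"
proof -
  \<comment> \<open>A coin \<open>b\<close> chooses the selection and a uniform index chooses the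
    atom. The second component ignores the coin, so the second marginal of the mixture is always the
    empirical distribution.\<close>
  define K where "K = (\<lambda>b. map_pmf (\<lambda>i. (if b then \<phi> i else \<psi> i, xihat i)) (pmf_of_set {1..N}))"
  define \<gamma> where "\<gamma> = bind_pmf (bernoulli_pmf \<theta>) K"
  have ne: "{1..N} \<noteq> {}" using N_pos by auto
  have setK: "set_pmf (K b) \<subseteq> S \<times> S" for b
    using \<phi> \<psi> obs ne by (auto simp: K_def set_pmf_of_set Pi_iff)
  have sub: "set_pmf \<gamma> \<subseteq> S \<times> S"
    using setK by (auto simp: \<gamma>_def)
  \<comment> \<open>One formula serves both for the transport cost and for the expectation of
    \<open>f\<close> under the first marginal.\<close>
  have ex: "measure_pmf.expectation \<gamma> u = \<theta> * ((\<Sum>i=1..N. u (\<phi> i, xihat i)) / N) +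
      (1 - \<theta>) * ((\<Sum>i=1..N. u (\<psi> i, xihat i)) / N)" for u :: "'a \<times> 'a \<Rightarrow> real"
  proof -
    have "measure_pmf.expectation \<gamma> u =
        (\<Sum>b\<in>UNIV. pmf (bernoulli_pmf \<theta>) b *\<^sub>R measure_pmf.expectation (K b) u)"
      unfolding \<gamma>_def
      by (rule pmf_expectation_bind) (use setK fin in \<open>auto intro: finite_subset[OF setK]\<close>)
    also have "\<dots> = (\<Sum>b\<in>UNIV. pmf (bernoulli_pmf \<theta>) b *\<^sub>R
        ((\<Sum>i=1..N. u (if b then \<phi> i else \<psi> i, xihat i)) / N))"
      unfolding K_def expectation_empirical ..
    finally show ?thesis using \<theta> by (simp add: UNIV_bool)
  qed
  define P where "P = map_pmf fst \<gamma>"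
  have "map_pmf snd \<gamma> = empirical N xihat"
    by (simp add: \<gamma>_def K_def map_bind_pmf map_pmf_comp o_def empirical_def)
  then have coup: "\<gamma> \<in> couplings P (empirical N xihat)"
    by (simp add: couplings_def P_def)
  have "wasserstein S d P (empirical N xihat) \<le> measure_pmf.expectation \<gamma> (\<lambda>(\<xi>, \<xi>'). d \<xi> \<xi>')"
    using wasserstein_le_transport_cost[OF coup] transport_cost_eq_expectation[OF sub] by simp
  also have "\<dots> \<le> \<epsilon>" using cost by (simp add: ex mean_cost_def)
  finally have "P \<in> wball" using sub by (auto simp: wball_def P_def)
  moreover have "measure_pmf.expectation P f = \<theta> * mean_gain \<phi> + (1 - \<theta>) * mean_gain \<psi>"
    by (simp add: P_def ex mean_gain_def)
  ultimately show thesis using that by blast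
qed

text \<open>This is the degenerate mixture: the same selection twice with \<theta> equal to
  1.\<close>

lemma selection_gain_le:
  assumes v: "\<And>P. P \<in> wball \<Longrightarrow> measure_pmf.expectation P f \<le> v"
    and "\<phi> \<in> {1..N} \<rightarrow> S" "mean_cost \<phi> \<le> \<epsilon>"
  shows "mean_gain \<phi> \<le> v"
proof -
  obtain P where "P \<in> wball" "measure_pmf.expectation P f = mean_gain \<phi>"
    using mixture_in_wball[OF assms(2,2), of 1] assms(3) by auto
  then show ?thesis using v by metis
qed

text \<open>Seen in the plane of (cost, gain) pairs of selections, \<open>\<alpha>\<close> is the smallest nonnegative slope
  of a line through \<open>(\<epsilon>, v)\<close> lying above all points to the right of \<open>\<epsilon>\<close>; mixing a point
  on the left with one on the right shows that the line is above the points on the left too.\<close>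
lemma strong_duality:
  assumes v: "\<And>P. P \<in> wball \<Longrightarrow> measure_pmf.expectation P f \<le> v"
  obtains \<alpha> where "0 \<le> \<alpha>" "dual_value \<alpha> \<le> v"
proof -
  \<comment> \<open>Extensional functions make the set of selections finite, so that the largest
    slope exists.\<close>
  define F where "F = {1..N} \<rightarrow>\<^sub>E S"
  define R where "R = {\<phi> \<in> F. \<epsilon> < mean_cost \<phi>}"
  define slopes where "slopes = (\<lambda>\<phi>. (mean_gain \<phi> - v) / (mean_cost \<phi> - \<epsilon>)) ` R"
  \<comment> \<open>Inserting 0 forces nonnegativity and covers the case that no selection exceeds
    the budget.\<close>
  define \<alpha> where "\<alpha> = Max (insert 0 slopes)"
  have FS: "\<phi> \<in> {1..N} \<rightarrow> S" if "\<phi> \<in> F" for \<phi> using that by (auto simp: F_def)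
  have "finite F" using fin by (simp add: F_def finite_PiE)
  then have fs: "finite slopes" by (simp add: slopes_def R_def)
  have \<alpha>0: "0 \<le> \<alpha>" using fs by (simp add: \<alpha>_def)
  have right: "mean_gain \<phi> - v \<le> \<alpha> * (mean_cost \<phi> - \<epsilon>)" if "\<phi> \<in> R" for \<phi>
  proof -
    have "(mean_gain \<phi> - v) / (mean_cost \<phi> - \<epsilon>) \<le> \<alpha>"
      unfolding \<alpha>_def using fs that by (intro Max_ge) (auto simp: slopes_def)
    then show ?thesis using that by (simp add: R_def pos_divide_le_eq)
  qed
  have left: "\<alpha> * (\<epsilon> - mean_cost \<phi>) \<le> v - mean_gain \<phi>" if "\<phi> \<in> F" "mean_cost \<phi> \<le> \<epsilon>" for \<phi>
  proof -
    note \<phi> = FS[OF that(1)]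
    have le: "mean_gain \<phi> \<le> v" using selection_gain_le[OF v \<phi> that(2)] .
    have "\<alpha> \<in> insert 0 slopes" unfolding \<alpha>_def using fs by (intro Max_in) auto
    then consider "\<alpha> = 0" | \<psi> where "\<psi> \<in> R" "\<alpha> = (mean_gain \<psi> - v) / (mean_cost \<psi> - \<epsilon>)"
      by (auto simp: slopes_def)
    then show ?thesis
    proof cases
      case 1
      then show ?thesis using le by simp
    next
      case (2 \<psi>)
      define D where "D = mean_cost \<psi> - mean_cost \<phi>"
      \<comment> \<open>With this weight the mixture of \<open>\<psi>\<close> and
        \<open>\<phi>\<close> costs exactly \<epsilon>. Here \<open>\<psi>\<close> is a selection
        whose slope is the maximal one.\<close>
      define \<theta> where "\<theta> = (\<epsilon> - mean_cost \<phi>) / D"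
      have D: "0 < D" and \<psi>: "\<psi> \<in> F" "\<epsilon> < mean_cost \<psi>"
        using 2(1) that(2) by (auto simp: D_def R_def)
      have \<theta>: "0 \<le> \<theta>" "\<theta> \<le> 1" using that(2) \<psi>(2) D by (auto simp: \<theta>_def D_def)
      have \<theta>D: "\<theta> * D = \<epsilon> - mean_cost \<phi>" using D by (simp add: \<theta>_def)
      have "\<theta> * mean_cost \<psi> + (1 - \<theta>) * mean_cost \<phi> \<le> \<epsilon>"
        using \<theta>D by (simp add: D_def algebra_simps)
      then obtain P where "P \<in> wball"
          "measure_pmf.expectation P f = \<theta> * mean_gain \<psi> + (1 - \<theta>) * mean_gain \<phi>"
        using mixture_in_wball[OF FS[OF \<psi>(1)] \<phi> \<theta>] by metis
      then have "\<theta> * mean_gain \<psi> + (1 - \<theta>) * mean_gain \<phi> \<le> v" using v by metis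
      then have "D * (\<theta> * mean_gain \<psi> + (1 - \<theta>) * mean_gain \<phi>) \<le> D * v"
        using D by (simp add: mult_left_mono)
      also have "D * (\<theta> * mean_gain \<psi> + (1 - \<theta>) * mean_gain \<phi>) =
          (\<theta> * D) * mean_gain \<psi> + (D - \<theta> * D) * mean_gain \<phi>" by (simp add: algebra_simps)
      finally have "(\<epsilon> - mean_cost \<phi>) * (mean_gain \<psi> - v) \<le>
          (v - mean_gain \<phi>) * (mean_cost \<psi> - \<epsilon>)"
        unfolding \<theta>D by (simp add: D_def algebra_simps)
      then have "(\<epsilon> - mean_cost \<phi>) * (mean_gain \<psi> - v) / (mean_cost \<psi> - \<epsilon>) \<le> v - mean_gain \<phi>"
        using \<psi>(2) by (simp add: pos_divide_le_eq)
      then show ?thesis unfolding 2(2) by (simp add: mult.commute)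
    qed
  qed
  have all: "\<alpha> * \<epsilon> + mean_gain \<phi> - \<alpha> * mean_cost \<phi> \<le> v" if "\<phi> \<in> F" for \<phi>
    using left[OF that] right[of \<phi>] that by (cases "\<epsilon> < mean_cost \<phi>") (auto simp: R_def algebra_simps)
  \<comment> \<open>Choosing a maximizer for each index gives one selection that realizes all the
    maxima in \<open>dual_value \<alpha>\<close>, so the bound for selections is a bound for the
    dual value.\<close>
  let ?g = "\<lambda>i \<xi>. f \<xi> - \<alpha> * d \<xi> (xihat i)"
  have "\<exists>\<xi>\<in>S. Max (?g i ` S) = ?g i \<xi>" for i
  proof -
    have "Max (?g i ` S) \<in> ?g i ` S" using fin S_nonempty by (intro Max_in) auto
    then show ?thesis by (rule imageE) blast
  qed
  then obtain sel where sel: "\<And>i. sel i \<in> S" "\<And>i. Max (?g i ` S) = ?g i (sel i)" by metis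
  let ?\<phi> = "restrict sel {1..N}"
  have "?\<phi> \<in> F" using sel(1) by (auto simp: F_def)
  moreover have "dual_value \<alpha> = \<alpha> * \<epsilon> + mean_gain ?\<phi> - \<alpha> * mean_cost ?\<phi>"
    using N_pos unfolding dual_value_def mean_gain_def mean_cost_def sel(2)
    by (simp add: sum_subtractf sum_distrib_left diff_divide_distrib)
  ultimately show thesis using that[OF \<alpha>0] all by metis
qed

text \<open>Leaving every atom in place costs nothing, so the empirical distribution itself lies in
  the ball.\<close>

lemma wball_nonempty: "wball \<noteq> {}"
proof -
  have "mean_cost xihat \<le> \<epsilon>" using eps by (simp add: mean_cost_def d_self)
  then show ?thesis using mixture_in_wball[of xihat xihat 1] obs by auto
qed

theorem duality:
  "(INF \<alpha>\<in>{0..}. ereal (dual_value \<alpha>)) = (SUP P\<in>wball. ereal (measure_pmf.expectation P f))"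
proof (rule antisym)
  let ?E = "\<lambda>P. measure_pmf.expectation P f"
  let ?s = "SUP P\<in>wball. ereal (?E P)"
  obtain P where P: "P \<in> wball" using wball_nonempty by blast
  \<comment> \<open>Weak duality at multiplier 0 bounds the supremum above and a member of the ball
    bounds it below, so it is a real number \<open>v\<close> and strong duality yields a multiplier
    attaining it.\<close>
  have "?s \<le> ereal (dual_value 0)" by (intro SUP_least) (simp add: weak_duality)
  moreover have "ereal (?E P) \<le> ?s" by (rule SUP_upper[OF P])
  ultimately obtain v where v: "?s = ereal v" by (cases ?s) auto
  have "?E P \<le> v" if "P \<in> wball" for P
    using SUP_upper[OF that, of "\<lambda>P. ereal (?E P)"] by (simp add: v)
  then obtain \<alpha> where "0 \<le> \<alpha>" "dual_value \<alpha> \<le> v" using strong_duality by blast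
  then show "(INF \<alpha>\<in>{0..}. ereal (dual_value \<alpha>)) \<le> ?s"
    unfolding v by (intro INF_lower2[of \<alpha>]) auto
  show "(SUP P\<in>wball. ereal (?E P)) \<le> (INF \<alpha>\<in>{0..}. ereal (dual_value \<alpha>))"
    by (intro SUP_least INF_greatest) (simp add: weak_duality)
qed

end

section \<open>The reformulation\<close>

text \<open>The constant is finite, so it can be subtracted again even where the other terms are
  infinite.\<close>

lemma INF_ereal_const_add:
  "(INF i\<in>I. ereal a + g i) = ereal a + (INF i\<in>I. g i)"
proof (rule antisym)
  have "(INF i\<in>I. ereal a + g i) - ereal a \<le> (INF i\<in>I. g i)"
    by (rule INF_greatest) (auto simp: ereal_minus_le add.commute intro: INF_lower)
  then show "(INF i\<in>I. ereal a + g i) \<le> ereal a + (INF i\<in>I. g i)"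
    by (simp add: ereal_minus_le add.commute)
  show "ereal a + (INF i\<in>I. g i) \<le> (INF i\<in>I. ereal a + g i)"
    by (intro INF_greatest add_left_mono INF_lower)
qed

lemma finite_binary_vectors: "finite {\<xi> :: real ^ 'm. \<forall>j. \<xi> $ j \<in> {0, 1}}"
proof -
  have "{\<xi> :: real ^ 'm. \<forall>j. \<xi> $ j \<in> {0, 1}} \<subseteq> vec_lambda ` (UNIV \<rightarrow>\<^sub>E {0, 1})"
    by (auto intro!: image_eqI[of _ vec_lambda "vec_nth _"])
  then show ?thesis by (rule finite_subset) (simp add: finite_PiE)
qed

theorem theorem2:
  fixes \<Xi> :: "(real ^ 'm) set"
    and N :: nat and xihat :: "nat \<Rightarrow> real ^ 'm"
    and X :: "(real ^ 'n1) set" and c :: "real ^ 'n1 \<Rightarrow> real"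
    and Y :: "(real ^ 'n2) set"
    and q0 :: "real ^ 'n2" and Qm :: "real ^ 'm ^ 'n2"
    and W0 :: "real ^ 'n2 ^ 'l" and W :: "'m \<Rightarrow> real ^ 'n2 ^ 'l"
    and T :: "real ^ 'n1 \<Rightarrow> real ^ 'm ^ 'l" and h :: "real ^ 'n1 \<Rightarrow> real ^ 'l"
    and nrm :: "real ^ 'm \<Rightarrow> real" and \<epsilon> :: real
  defines "Q \<equiv> second_stage Y q0 Qm W0 W T h"
    and "\<P> \<equiv> ambiguity_set \<Xi> nrm N xihat \<epsilon>"
    and "Z \<equiv> (\<lambda>i. Zval T h (lifted_set \<Xi> nrm Y q0 Qm W0 W (xihat i)))"
  assumes binary: "\<Xi> \<subseteq> {\<xi>. \<forall>j. \<xi> $ j \<in> {0, 1}}"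
    and N_pos: "1 \<le> N"
    and obs: "\<And>i. i \<in> {1..N} \<Longrightarrow> xihat i \<in> \<Xi>"
    and X: "convex X" "compact X"
    and c: "convex_on X c"
    and Y: "proper_cone Y"
    and h: "\<And>l. closed_proper_convex_on X (\<lambda>x. h x $ l)"
    and T: "\<And>l j. closed_proper_convex_on X (\<lambda>x. T x $ l $ j)"
    and nrm: "is_norm nrm"
    and eps: "0 \<le> \<epsilon>"
    and A1: "\<And>\<xi>. \<xi> \<in> \<Xi> \<Longrightarrow> \<exists>y \<in> interior Y. \<forall>l. 0 < (recourse_mat W0 W \<xi> *v y) $ l"
    and A2: "\<And>x \<xi>. x \<in> X \<Longrightarrow> \<xi> \<in> \<Xi> \<Longrightarrow> \<bar>Q x \<xi>\<bar> \<noteq> \<infinity>"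
  shows "(\<forall>i\<in>{1..N}. \<forall>x\<in>X. \<forall>\<alpha>\<ge>0. \<bar>Z i x \<alpha>\<bar> \<noteq> \<infinity>) \<and>
    (\<forall>x\<in>X. (INF \<alpha>\<in>{0..}. reformulated_objective c \<epsilon> N Z x \<alpha>) = dro_objective c Q \<P> x) \<and>
    (INF x\<in>X. dro_objective c Q \<P> x) =
      (INF (x, \<alpha>)\<in>X \<times> {0..}. reformulated_objective c \<epsilon> N Z x \<alpha>)"
proof -
  have fin: "finite \<Xi>" using binary finite_binary_vectors by (rule finite_subset)
  have ne: "\<Xi> \<noteq> {}" using obs[of 1] N_pos by auto
  have cone: "convex Y" "cone Y" using Y by (auto simp: proper_cone_def)
  have slater: "\<exists>y\<in>Y. \<forall>l. 0 < (recourse_mat W0 W \<xi> *v y) $ l" if "\<xi> \<in> \<Xi>" for \<xi>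
    using A1[OF that] interior_subset by blast
  let ?f = "\<lambda>x \<xi>. real_of_ereal (Q x \<xi>)"
  \<comment> \<open>By (A2) the loss is finite on \<Xi>, so passing to \<open>real_of_ereal\<close>
    there loses nothing.\<close>
  have Z_eq: "Z i x \<alpha> = ereal (MAX \<xi>\<in>\<Xi>. ?f x \<xi> - \<alpha> * nrm (\<xi> - xihat i))"
    if "x \<in> X" "0 \<le> \<alpha>" for i x \<alpha>
    unfolding Z_def
    by (rule Zval_lifted_set[OF fin ne cone nrm that(2) slater])
       (use A2[OF that(1)] in \<open>auto simp: Q_def ereal_real\<close>)
  have fixed_x: "(INF \<alpha>\<in>{0..}. reformulated_objective c \<epsilon> N Z x \<alpha>) = dro_objective c Q \<P> x"
    if x: "x \<in> X" for x
  proof -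
    interpret finite_transport \<Xi> "\<lambda>\<xi> \<xi>'. nrm (\<xi> - \<xi>')" N xihat "?f x" \<epsilon>
      using fin N_pos obs nrm eps by unfold_locales (auto simp: is_norm_def)
    have "reformulated_objective c \<epsilon> N Z x \<alpha> = ereal (c x) + ereal (dual_value \<alpha>)"
      if "0 \<le> \<alpha>" for \<alpha>
      by (simp add: reformulated_objective_def Z_eq[OF x that] dual_value_def)
    then have "(INF \<alpha>\<in>{0..}. reformulated_objective c \<epsilon> N Z x \<alpha>) =
        (INF \<alpha>\<in>{0..}. ereal (c x) + ereal (dual_value \<alpha>))"
      by (intro INF_cong) auto
    also have "\<dots> = ereal (c x) + (INF \<alpha>\<in>{0..}. ereal (dual_value \<alpha>))"
      by (rule INF_ereal_const_add)
    also have "\<dots> = dro_objective c Q \<P> x"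
      unfolding duality by (simp add: dro_objective_def \<P>_def ambiguity_set_def wball_def expected_loss_def)
    finally show ?thesis .
  qed
  \<comment> \<open>The joint infimum is an iterated one, so the identity at each fixed
    \<open>x\<close> gives equality of the optimal values.\<close>
  have "(INF (x, \<alpha>)\<in>X \<times> {0..}. reformulated_objective c \<epsilon> N Z x \<alpha>) =
      (INF x\<in>X. INF \<alpha>\<in>{0..}. reformulated_objective c \<epsilon> N Z x \<alpha>)"
    by (intro antisym INF_greatest) (auto intro: INF_lower2 INF_lower)
  then show ?thesis using fixed_x Z_eq by simp
qed

end
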